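(* Let $s$ be an even positive integer and $t$ an odd positive integer with $s$ and $t$ coprime. Then there is a bijection between the set $\mathcal{DD}_{(s,t)}$ of doubled distinct $(s,t)$-core partitions and the set $\mathcal{NE}((t-1)/2,(s-2)/2)$ of north-east lattice paths. In addition, \[ |\mathcal{DD}_{(s,t)}|=\binom{(s-2)/2 + (t-1)/2}{(s-2)/2}. \]
   Context: A strict partition $\lambda=(\lambda_1>\lambda_2>\cdots>\lambda_\ell)$ is a finite (possibly empty) strictly decreasing sequence of positive integers. For a strict partition $\lambda$, the doubled distinct partition $\lambda\lambda$ is the ordinary partition with Frobenius symbol $\begin{pmatrix}\lambda_1&\cdots&\lambda_\ell\\ \lambda_1-1&\cdots&\lambda_\ell-1\end{pmatrix}$ (the $i$th diagonal box has arm length $\lambda_i$ and leg length $\lambda_i-1$). It is a doubled distinct $s$-core if no hook length of its Young diagram is divisible by $s$. $\mathcal{DD}_{(s,t)}$ is the set of doubled distinct partitions that are both doubled distinct $s$-cores and doubled distinct $t$-cores (the empty partition included). $\mathcal{NE}(a,b)$ denotes the set of lattice paths from $(0,0)$ to $(a,b)$ consisting of steps $N=(0,1)$ and $E=(1,0)$. *)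

theory Defs
  imports Complex_Main "HOL-Library.Product_Plus"
begin

definition is_partition :: "nat list \<Rightarrow> bool" where
  "is_partition \<mu> \<longleftrightarrow> sorted_wrt (\<ge>) \<mu> \<and> 0 \<notin> set \<mu>"

definition strict_partition :: "nat list \<Rightarrow> bool" where
  "strict_partition \<alpha> \<longleftrightarrow> sorted_wrt (>) \<alpha> \<and> 0 \<notin> set \<alpha>"

text \<open>Boxes are pairs (row, column), both counted from 0.\<close>

definition young :: "nat list \<Rightarrow> (nat \<times> nat) set" where
  "young \<mu> = {(i, j). i < length \<mu> \<and> j < \<mu> ! i}"

definition arm :: "nat list \<Rightarrow> nat \<Rightarrow> nat \<Rightarrow> nat" where
  "arm \<mu> i j = card {j'. j < j' \<and> (i, j') \<in> young \<mu>}"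

definition leg :: "nat list \<Rightarrow> nat \<Rightarrow> nat \<Rightarrow> nat" where
  "leg \<mu> i j = card {i'. i < i' \<and> (i', j) \<in> young \<mu>}"

definition hook_length :: "nat list \<Rightarrow> nat \<Rightarrow> nat \<Rightarrow> nat" where
  "hook_length \<mu> i j = arm \<mu> i j + leg \<mu> i j + 1"

definition diag_length :: "nat list \<Rightarrow> nat" where
  "diag_length \<mu> = card {i. (i, i) \<in> young \<mu>}"

text \<open>The two rows of the Frobenius symbol. For a partition the diagonal boxes are
  exactly those with index below \<open>diag_length\<close>.\<close>

definition frobenius :: "nat list \<Rightarrow> nat list \<times> nat list" where
  "frobenius \<mu> = (map (\<lambda>i. arm \<mu> i i) [0..<diag_length \<mu>],
                  map (\<lambda>i. leg \<mu> i i) [0..<diag_length \<mu>])"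

definition is_doubled_distinct_of :: "nat list \<Rightarrow> nat list \<Rightarrow> bool" where
  "is_doubled_distinct_of \<alpha> \<mu> \<longleftrightarrow>
     is_partition \<mu> \<and> frobenius \<mu> = (\<alpha>, map (\<lambda>k. k - 1) \<alpha>)"

definition doubled_distinct :: "nat list \<Rightarrow> bool" where
  "doubled_distinct \<mu> \<longleftrightarrow> (\<exists>\<alpha>. strict_partition \<alpha> \<and> is_doubled_distinct_of \<alpha> \<mu>)"

definition is_core :: "nat \<Rightarrow> nat list \<Rightarrow> bool" where
  "is_core s \<mu> \<longleftrightarrow> (\<forall>(i, j) \<in> young \<mu>. \<not> s dvd hook_length \<mu> i j)"

definition DD :: "nat \<Rightarrow> nat \<Rightarrow> nat list set" where
  "DD s t = {\<mu>. doubled_distinct \<mu> \<and> is_core s \<mu> \<and> is_core t \<mu>}"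

datatype step = North | East

fun step_vec :: "step \<Rightarrow> nat \<times> nat" where
  "step_vec North = (0, 1)"
| "step_vec East = (1, 0)"

fun walk :: "nat \<times> nat \<Rightarrow> step list \<Rightarrow> nat \<times> nat" where
  "walk p [] = p"
| "walk p (x # xs) = walk (p + step_vec x) xs"

text \<open>A lattice path from the origin is encoded by its sequence of steps.\<close>

definition NE :: "nat \<Rightarrow> nat \<Rightarrow> step list set" where
  "NE a b = {w. walk (0, 0) w = (a, b)}"

end

theory Submission imports Defs begin

text \<open>
  Read a partition \<open>\<mu>\<close> as its bead set \<open>M = {\<mu>\<^sub>i - i - 1 | i \<ge> 0}\<close>, a set of integers bounded above
  that contains almost all negative integers. The integers outside \<open>M\<close>, the gaps, come from the columns
  of \<open>\<mu>\<close> in the same way, and the hook length of a box is the bead of its row minus the gap of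
  its column. So \<open>\<mu>\<close> is an \<open>s\<close>-core iff \<open>M\<close> is closed under subtracting \<open>s\<close>
  (\<open>is_core_iff_sub_closed\<close>). The nonnegative beads are the diagonal arms and the negative
  gaps are \<open>-1 - leg\<close>, so the doubled distinct partitions are exactly those
  for which \<open>0 \<notin> M\<close> and, for each \<open>x \<noteq> 0\<close>, exactly one of \<open>x\<close> and \<open>-x\<close> lies in \<open>M\<close>
  (\<open>doubled_distinct_iff_antisymmetric\<close>). Conversely this symmetry forces as many
  nonnegative beads as negative gaps, and hence every such set bounded above is a bead set (\<open>maya_surj\<close>).
  Closure under both subtractions provides the bound (\<open>core_set_bounded\<close>). The problem becomes one about antisymmetric sets of integers closed under
  subtracting \<open>s\<close> and \<open>t\<close>.

  Write \<open>s = 2h\<close> and \<open>t = 2a + 1\<close>. As \<open>s\<close> and \<open>t\<close> are coprime, every integer is of the form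
  \<open>j t - (i + 1) s\<close>, where \<open>(j, i)\<close> is unique up to multiples of \<open>(s, t)\<close>. In these coordinates a
  closed set consists of the points on or above the graph of a weakly increasing function \<open>D\<close> on the
  integers with \<open>D (j + s) = D j + t\<close>. Antisymmetry says that \<open>D (-j) = -1 - D j\<close>
  unless \<open>s\<close> divides \<open>j\<close>, and that \<open>D 0 = 0\<close>. Putting \<open>j = h\<close> into the two relations gives
  \<open>D h = a\<close>. Hence \<open>D\<close> is determined by the values \<open>D 1 \<le> \<dots> \<le> D (h - 1)\<close> between \<open>0\<close> and \<open>a\<close>
  (\<open>core_set_eqI\<close>), and conversely any such values extend by the two relations to an admissible \<open>D\<close>
  (\<open>skyline_set_mem_core_sets\<close>). Finally, a weakly increasing list of \<open>h - 1\<close> numbers between \<open>0\<close>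
  and \<open>a\<close> is the same as a north-east path to \<open>(a, h - 1)\<close>: the \<open>k\<close>-th number counts the
  east steps before the \<open>k\<close>-th north step.
\<close>

section \<open>Rows, columns and boundary labels\<close>

definition row :: "nat list \<Rightarrow> nat \<Rightarrow> nat" where
  "row \<mu> i = (if i < length \<mu> then \<mu> ! i else 0)"

definition col :: "nat list \<Rightarrow> nat \<Rightarrow> nat" where
  "col \<mu> j = card {i. j < row \<mu> i}"

text \<open>Beads and gaps label the steps of the boundary path of the Young diagram by consecutive
  integers: row \<open>i\<close> ends in the step \<open>bead \<mu> i\<close> and column \<open>j\<close> in the step \<open>gap \<mu> j\<close>.
  Row indices run through all of \<open>nat\<close>, so rows beyond the partition yield the beads
  \<open>-i - 1\<close>.\<close>

definition bead :: "nat list \<Rightarrow> nat \<Rightarrow> int" where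
  "bead \<mu> i = int (row \<mu> i) - int i - 1"

definition gap :: "nat list \<Rightarrow> nat \<Rightarrow> int" where
  "gap \<mu> j = int j - int (col \<mu> j)"

definition maya :: "nat list \<Rightarrow> int set" where
  "maya \<mu> = range (bead \<mu>)"

lemma finite_initial_segment:
  fixes A :: "nat set"
  assumes "finite A" and "\<And>x y. x \<in> A \<Longrightarrow> y \<le> x \<Longrightarrow> y \<in> A"
  shows "A = {..<card A}"
proof -
  define n where "n = (LEAST n. n \<notin> A)"
  have "\<exists>n. n \<notin> A"
    using assms(1) ex_new_if_finite infinite_UNIV_nat by blast
  then have "n \<notin> A" unfolding n_def by (rule LeastI_ex)
  moreover have "m \<in> A" if "m < n" for m
    using that not_less_Least unfolding n_def by blast
  ultimately have "A = {..<n}"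
    using assms(2) by (metis equalityI lessThan_iff not_le subsetI)
  then show ?thesis by simp
qed

lemma row_antimono:
  assumes "is_partition \<mu>" and "i \<le> i'"
  shows "row \<mu> i' \<le> row \<mu> i"
  using assms by (cases "i = i'") (auto simp: row_def is_partition_def sorted_wrt_iff_nth_less)

lemma finite_row_greater: "finite {i. j < row \<mu> i}"
  by (rule finite_subset[of _ "{..<length \<mu>}"]) (auto simp: row_def split: if_splits)

text \<open>This is the duality between a partition and its conjugate: row lengths decrease, so the
  rows that are longer than \<open>j\<close> are the first \<open>col \<mu> j\<close> ones.\<close>

lemma less_row_iff_less_col:
  assumes "is_partition \<mu>"
  shows "j < row \<mu> i \<longleftrightarrow> i < col \<mu> j"
proof -
  have "{i. j < row \<mu> i} = {..<col \<mu> j}"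
    unfolding col_def
    by (rule finite_initial_segment[OF finite_row_greater])
       (use row_antimono[OF assms] in \<open>fastforce intro: less_le_trans\<close>)
  then show ?thesis by blast
qed

lemma young_iff_less_row: "(i, j) \<in> young \<mu> \<longleftrightarrow> j < row \<mu> i"
  by (auto simp: young_def row_def)

lemma arm_eq: "arm \<mu> i j = row \<mu> i - j - 1"
proof -
  have "{j'. j < j' \<and> (i, j') \<in> young \<mu>} = {j<..<row \<mu> i}"
    by (auto simp: young_iff_less_row)
  then show ?thesis by (simp add: arm_def)
qed

lemma leg_eq:
  assumes "is_partition \<mu>"
  shows "leg \<mu> i j = col \<mu> j - i - 1"
proof -
  have "{i'. i < i' \<and> (i', j) \<in> young \<mu>} = {i<..<col \<mu> j}"
    by (auto simp: young_iff_less_row less_row_iff_less_col[OF assms])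
  then show ?thesis by (simp add: leg_def)
qed

lemma bead_strict_antimono:
  assumes "is_partition \<mu>" and "i < i'"
  shows "bead \<mu> i' < bead \<mu> i"
  using row_antimono[OF assms(1), of i i'] assms(2) by (simp add: bead_def)

lemma bead_less_iff:
  assumes "is_partition \<mu>"
  shows "bead \<mu> i' < bead \<mu> i \<longleftrightarrow> i < i'"
  using bead_strict_antimono[OF assms] by (metis linorder_neqE_nat order_less_asym order_less_irrefl)

lemma col_antimono:
  assumes "j \<le> j'"
  shows "col \<mu> j' \<le> col \<mu> j"
  unfolding col_def by (rule card_mono[OF finite_row_greater]) (use assms in auto)

lemma gap_strict_mono: "j < j' \<Longrightarrow> gap \<mu> j < gap \<mu> j'"
  using col_antimono[of j j' \<mu>] by (simp add: gap_def)

lemma gap_less_bead_iff: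
  assumes "is_partition \<mu>"
  shows "gap \<mu> j < bead \<mu> i \<longleftrightarrow> j < row \<mu> i"
  using less_row_iff_less_col[OF assms, of j i] by (auto simp: gap_def bead_def)

lemma gap_neq_bead:
  assumes "is_partition \<mu>"
  shows "gap \<mu> j \<noteq> bead \<mu> i"
  using less_row_iff_less_col[OF assms, of j i] by (auto simp: gap_def bead_def)

text \<open>Every step of the boundary path is a row end or a column end. For a nonbead \<open>x\<close>, let
  \<open>i\<close> be the first row whose bead lies below \<open>x\<close>; then the column with index \<open>x + i\<close> has length exactly
  \<open>i\<close>, because it ends between the beads of rows \<open>i - 1\<close> and \<open>i\<close>.\<close>

lemma range_gap:
  assumes "is_partition \<mu>"
  shows "range (gap \<mu>) = - maya \<mu>"
proof
  show "range (gap \<mu>) \<subseteq> - maya \<mu>"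
    using gap_neq_bead[OF assms] by (fastforce simp: maya_def)
  show "- maya \<mu> \<subseteq> range (gap \<mu>)"
  proof
    fix x assume x: "x \<in> - maya \<mu>"
    define i where "i = (LEAST i. bead \<mu> i < x)"
    have "bead \<mu> (length \<mu> + nat (- x)) < x" by (simp add: bead_def row_def)
    then have i: "bead \<mu> i < x" unfolding i_def by (rule LeastI)
    define j where "j = nat (x + int i)"
    have j: "int j = x + int i" using i by (simp add: j_def bead_def)
    have "row \<mu> i \<le> j" using i j by (simp add: bead_def)
    then have "col \<mu> j \<le> i" using less_row_iff_less_col[OF assms, of j i] by simp
    moreover have "i \<le> col \<mu> j"
    proof (cases i)
      case (Suc i')
      then have "\<not> bead \<mu> i' < x" using not_less_Least[of i' "\<lambda>i. bead \<mu> i < x"] i_def by simp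
      moreover have "bead \<mu> i' \<noteq> x" using x by (auto simp: maya_def)
      ultimately have "j < row \<mu> i'" using j Suc by (simp add: bead_def)
      then show ?thesis using less_row_iff_less_col[OF assms, of j i'] Suc by simp
    qed simp
    ultimately have "gap \<mu> j = x" using j by (simp add: gap_def)
    then show "x \<in> range (gap \<mu>)" by blast
  qed
qed

lemma not_mem_maya_iff:
  assumes "is_partition \<mu>"
  shows "x \<notin> maya \<mu> \<longleftrightarrow> (\<exists>j. x = gap \<mu> j)"
  using range_gap[OF assms] by blast

lemma hook_length_eq:
  assumes "is_partition \<mu>" and "(i, j) \<in> young \<mu>"
  shows "int (hook_length \<mu> i j) = bead \<mu> i - gap \<mu> j"
  using assms less_row_iff_less_col[OF assms(1), of j i]
  by (simp add: hook_length_def arm_eq leg_eq young_iff_less_row bead_def gap_def)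

section \<open>Cores are closed bead sets\<close>

definition sub_closed :: "nat \<Rightarrow> int set \<Rightarrow> bool" where
  "sub_closed s M \<longleftrightarrow> (\<forall>x\<in>M. x - int s \<in> M)"

lemma sub_closed_mult:
  assumes "sub_closed s M" and "x \<in> M"
  shows "x - int k * int s \<in> M"
proof (induction k)
  case (Suc k)
  then have "x - int k * int s - int s \<in> M" using assms(1) by (simp add: sub_closed_def)
  then show ?case by (simp add: algebra_simps)
qed (use assms in simp)

text \<open>A bead \<open>x\<close> and a gap \<open>x - s\<close> give a box with hook length \<open>s\<close>. Conversely, a hook
  length \<open>k s\<close> gives a bead and a gap that differ by \<open>k s\<close>, and \<open>k\<close> subtractions of \<open>s\<close> would turn the
  gap into a bead.\<close>

lemma is_core_iff_sub_closed:
  assumes "is_partition \<mu>" and "0 < s"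
  shows "is_core s \<mu> \<longleftrightarrow> sub_closed s (maya \<mu>)"
proof
  assume core: "is_core s \<mu>"
  show "sub_closed s (maya \<mu>)"
    unfolding sub_closed_def
  proof (rule ballI, rule ccontr)
    fix x assume "x \<in> maya \<mu>" and "x - int s \<notin> maya \<mu>"
    then obtain i j where ij: "x = bead \<mu> i" "x - int s = gap \<mu> j"
      unfolding not_mem_maya_iff[OF assms(1)] by (auto simp: maya_def)
    then have y: "(i, j) \<in> young \<mu>"
      using gap_less_bead_iff[OF assms(1), of j i] assms(2) by (simp add: young_iff_less_row)
    then have "int (hook_length \<mu> i j) = int s"
      using hook_length_eq[OF assms(1)] ij by simp
    with core y show False by (auto simp: is_core_def)
  qed
next
  assume closed: "sub_closed s (maya \<mu>)"
  show "is_core s \<mu>"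
    unfolding is_core_def
  proof safe
    fix i j assume y: "(i, j) \<in> young \<mu>" and "s dvd hook_length \<mu> i j"
    then obtain k where "hook_length \<mu> i j = s * k" by (auto simp: dvd_def)
    then have "gap \<mu> j = bead \<mu> i - int k * int s"
      using hook_length_eq[OF assms(1) y] by (simp add: algebra_simps)
    then have "gap \<mu> j \<in> maya \<mu>"
      using sub_closed_mult[OF closed, of "bead \<mu> i" k] by (simp add: maya_def)
    then show False using range_gap[OF assms(1)] by blast
  qed
qed

section \<open>Doubled distinct partitions are antisymmetric bead sets\<close>

definition antisymmetric_set :: "int set \<Rightarrow> bool" where
  "antisymmetric_set M \<longleftrightarrow> 0 \<notin> M \<and> (\<forall>x. x \<noteq> 0 \<longrightarrow> (- x \<in> M \<longleftrightarrow> x \<notin> M))"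

lemma diag_box_iff:
  assumes "is_partition \<mu>"
  shows "i < diag_length \<mu> \<longleftrightarrow> 0 \<le> bead \<mu> i" and "i < diag_length \<mu> \<longleftrightarrow> gap \<mu> i < 0"
proof -
  have "{i. (i, i) \<in> young \<mu>} = {..<diag_length \<mu>}"
    unfolding diag_length_def
  proof (rule finite_initial_segment)
    show "finite {i. (i, i) \<in> young \<mu>}"
      by (rule finite_subset[of _ "{..<length \<mu>}"]) (auto simp: young_def)
    fix x y assume "x \<in> {i. (i, i) \<in> young \<mu>}" and "y \<le> x"
    then show "y \<in> {i. (i, i) \<in> young \<mu>}"
      using row_antimono[OF assms, of y x] by (simp add: young_iff_less_row)
  qed
  then have *: "i < diag_length \<mu> \<longleftrightarrow> i < row \<mu> i"
    by (auto simp: young_iff_less_row)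
  show "i < diag_length \<mu> \<longleftrightarrow> 0 \<le> bead \<mu> i" using * by (auto simp: bead_def)
  show "i < diag_length \<mu> \<longleftrightarrow> gap \<mu> i < 0"
    using * less_row_iff_less_col[OF assms, of i i] by (auto simp: gap_def)
qed

lemma frobenius_eq:
  assumes "is_partition \<mu>"
  shows "frobenius \<mu> = (map (\<lambda>i. nat (bead \<mu> i)) [0..<diag_length \<mu>],
                       map (\<lambda>i. nat (- gap \<mu> i - 1)) [0..<diag_length \<mu>])"
  unfolding frobenius_def
  by (auto simp: arm_eq leg_eq[OF assms] bead_def gap_def)

lemma sorted_desc_unique:
  fixes xs ys :: "nat list"
  assumes "sorted_wrt (>) xs" and "sorted_wrt (>) ys" and "set xs = set ys"
  shows "xs = ys"
  using strict_sorted_equal[of "rev xs" "rev ys"] assms by (simp add: sorted_wrt_rev)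

text \<open>In the Frobenius symbol the arms are the nonnegative beads and the legs are
  \<open>-1 - y\<close> for the negative gaps \<open>y\<close>. The condition that each leg is one less than its arm, with
  positive arms, says that the negative gaps are the negatives of the nonnegative beads, and that \<open>0\<close> is not a
  bead. The symbol is a pair of lists in decreasing order, so that comparing the underlying sets is
  enough.\<close>

lemma doubled_distinct_iff_antisymmetric:
  assumes "is_partition \<mu>"
  shows "doubled_distinct \<mu> \<longleftrightarrow> antisymmetric_set (maya \<mu>)"
proof -
  let ?d = "diag_length \<mu>"
  let ?arms = "map (\<lambda>i. nat (bead \<mu> i)) [0..<?d]"
  let ?legs = "map (\<lambda>i. nat (- gap \<mu> i - 1)) [0..<?d]"
  note diag = diag_box_iff[OF assms]
  have nonneg: "x \<in> maya \<mu> \<and> 0 \<le> x \<longleftrightarrow> (\<exists>i<?d. x = bead \<mu> i)" for x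
    using diag(1) by (auto simp: maya_def)
  have missing: "x \<notin> maya \<mu> \<and> x < 0 \<longleftrightarrow> (\<exists>i<?d. x = gap \<mu> i)" for x
    unfolding not_mem_maya_iff[OF assms] using diag(2) by auto
  have arms: "sorted_wrt (>) ?arms"
  proof -
    have "nat (bead \<mu> j) < nat (bead \<mu> i)" if "i < j" "j < ?d" for i j
      using bead_strict_antimono[OF assms that(1)] diag(1)[of j] that(2) by simp
    then show ?thesis by (auto simp: sorted_wrt_iff_nth_less)
  qed
  have legs: "sorted_wrt (>) ?legs"
  proof -
    have "nat (- gap \<mu> j - 1) < nat (- gap \<mu> i - 1)" if "i < j" "j < ?d" for i j
      using gap_strict_mono[OF that(1), of \<mu>] diag(2)[of j] that(2) by linarith
    then show ?thesis by (auto simp: sorted_wrt_iff_nth_less)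
  qed
  have "doubled_distinct \<mu> \<longleftrightarrow> 0 \<notin> set ?arms \<and> ?legs = map (\<lambda>k. k - 1) ?arms"
    using arms
    by (auto simp: doubled_distinct_def is_doubled_distinct_of_def assms frobenius_eq[OF assms]
        strict_partition_def)
  also have "\<dots> \<longleftrightarrow> antisymmetric_set (maya \<mu>)"
  proof
    assume *: "0 \<notin> set ?arms \<and> ?legs = map (\<lambda>k. k - 1) ?arms"
    have pos: "0 < bead \<mu> i" if "i < ?d" for i
      using * that diag(1)[of i] by (fastforce simp: order_le_less)
    have opp: "gap \<mu> i = - bead \<mu> i" if "i < ?d" for i
    proof -
      have "nat (- gap \<mu> i - 1) = nat (bead \<mu> i) - 1"
        using * that by (auto simp: map_eq_conv)
      then show ?thesis using pos[OF that] diag(2)[of i] that by linarith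
    qed
    have zero: "0 \<notin> maya \<mu>" using nonneg[of 0] pos by (metis order_less_irrefl order_refl)
    have key: "- x \<notin> maya \<mu> \<longleftrightarrow> x \<in> maya \<mu>" if "0 < x" for x
      using nonneg[of x] missing[of "- x"] opp that
      by (metis add.inverse_inverse less_imp_le neg_less_0_iff_less)
    show "antisymmetric_set (maya \<mu>)"
      unfolding antisymmetric_set_def
      using zero key by (metis add.inverse_inverse linorder_neqE neg_0_less_iff_less)
  next
    assume anti: "antisymmetric_set (maya \<mu>)"
    have zero: "0 \<notin> set ?arms"
    proof
      assume "0 \<in> set ?arms"
      then obtain i where "i < ?d" "bead \<mu> i \<le> 0" by auto
      then have "bead \<mu> i = 0" using diag(1)[of i] by simp
      then have "0 \<in> maya \<mu>" by (metis maya_def rangeI)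
      then show False using anti by (simp add: antisymmetric_set_def)
    qed
    have pos: "0 < bead \<mu> i" if "i < ?d" for i
      using zero that by force
    have opp: "(\<exists>i<?d. x = gap \<mu> i) \<longleftrightarrow> (\<exists>i<?d. - x = bead \<mu> i)" for x
      unfolding nonneg[symmetric] missing[symmetric]
      using anti by (auto simp: antisymmetric_set_def order_le_less)
    have "set ?legs = set (map (\<lambda>k. k - 1) ?arms)"
    proof (intro equalityI subsetI)
      fix n assume "n \<in> set ?legs"
      then obtain i where i: "i < ?d" "n = nat (- gap \<mu> i - 1)" by auto
      then obtain k where "k < ?d" "- gap \<mu> i = bead \<mu> k" using opp by blast
      then show "n \<in> set (map (\<lambda>k. k - 1) ?arms)" using i by (force simp: nat_diff_distrib)
    next
      fix n assume "n \<in> set (map (\<lambda>k. k - 1) ?arms)"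
      then obtain k where k: "k < ?d" "n = nat (bead \<mu> k) - 1" by auto
      then obtain i where "i < ?d" "- bead \<mu> k = gap \<mu> i"
        using opp[of "- bead \<mu> k"] by auto
      then show "n \<in> set ?legs" using k by (force simp: nat_diff_distrib)
    qed
    moreover have "sorted_wrt (>) (map (\<lambda>k. k - 1) ?arms)"
    proof -
      have "nat (bead \<mu> j) - 1 < nat (bead \<mu> i) - 1" if "i < j" "j < ?d" for i j
        using bead_strict_antimono[OF assms that(1)] pos[OF that(2)] by linarith
      then show ?thesis by (auto simp: sorted_wrt_iff_nth_less)
    qed
    ultimately show "0 \<notin> set ?arms \<and> ?legs = map (\<lambda>k. k - 1) ?arms"
      using zero sorted_desc_unique[OF legs] by blast
  qed
  finally show ?thesis .
qed

section \<open>Reconstructing a partition from its bead set\<close>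

text \<open>The \<open>i\<close>-th bead is the unique element of the bead set with exactly \<open>i\<close> larger
  elements.\<close>

lemma bead_eq_if_same_maya:
  assumes "is_partition \<mu>" and "is_partition \<nu>" and "maya \<mu> = maya \<nu>"
  shows "bead \<mu> i = bead \<nu> i"
proof -
  have rank: "card {y \<in> maya \<kappa>. bead \<kappa> k < y} = k" if "is_partition \<kappa>" for \<kappa> k
  proof -
    have "{y \<in> maya \<kappa>. bead \<kappa> k < y} = bead \<kappa> ` {..<k}"
      by (auto simp: maya_def bead_less_iff[OF that])
    moreover have "inj_on (bead \<kappa>) {..<k}"
      by (rule inj_onI) (metis bead_less_iff[OF that] linorder_neqE_nat order_less_irrefl)
    ultimately show ?thesis by (simp add: card_image)
  qed
  obtain k where k: "bead \<mu> i = bead \<nu> k"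
    using assms(3) by (metis maya_def rangeE rangeI)
  then have "i = k"
    using rank[OF assms(1), of i] rank[OF assms(2), of k] assms(3) by simp
  then show ?thesis using k by simp
qed

lemma maya_inject:
  assumes "is_partition \<mu>" and "is_partition \<nu>" and "maya \<mu> = maya \<nu>"
  shows "\<mu> = \<nu>"
proof -
  have row: "row \<mu> i = row \<nu> i" for i
    using bead_eq_if_same_maya[OF assms, of i] by (simp add: bead_def)
  have len: "i < length \<kappa> \<longleftrightarrow> row \<kappa> i \<noteq> 0" if "is_partition \<kappa>" for \<kappa> i
    using that by (metis is_partition_def nth_mem row_def)
  have "length \<mu> = length \<nu>"
    using len[OF assms(1)] len[OF assms(2)] row by (metis linorder_neqE_nat order_less_irrefl)
  then show ?thesis
    using row unfolding row_def by (intro nth_equalityI) metis+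
qed

lemma partition_with_rows:
  fixes p :: "nat \<Rightarrow> nat"
  assumes "\<And>i j. i \<le> j \<Longrightarrow> p j \<le> p i" and "p n = 0"
  shows "\<exists>\<mu>. is_partition \<mu> \<and> row \<mu> = p"
proof -
  define L where "L = (LEAST n. p n = 0)"
  have "p L = 0" unfolding L_def using assms(2) by (rule LeastI)
  then have ge: "p i = 0" if "L \<le> i" for i
    using assms(1)[OF that] by simp
  have lt: "p i \<noteq> 0" if "i < L" for i
    using that not_less_Least unfolding L_def by blast
  have "is_partition (map p [0..<L])"
    using assms(1) lt by (fastforce simp: is_partition_def sorted_wrt_iff_nth_less)
  moreover have "row (map p [0..<L]) = p"
    using ge by (auto simp: row_def fun_eq_iff)
  ultimately show ?thesis by blast
qed

text \<open>Each pair \<open>\<plusminus>k\<close> with \<open>1 \<le> k \<le> n\<close> contributes exactly one element. The window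
  thus holds as many elements as for the empty partition, whose bead set is the set of all negative
  integers.\<close>

lemma card_window_antisymmetric:
  assumes "antisymmetric_set M"
  shows "card (M \<inter> {- int n..int n}) = n"
proof -
  let ?E = "M \<inter> {- int n..int n}"
  have "bij_betw (\<lambda>x. nat \<bar>x\<bar>) ?E {1..n}"
    unfolding bij_betw_def
  proof
    show "inj_on (\<lambda>x. nat \<bar>x\<bar>) ?E"
    proof (rule inj_onI)
      fix x y assume xy: "x \<in> ?E" "y \<in> ?E" "nat \<bar>x\<bar> = nat \<bar>y\<bar>"
      then have "y = x \<or> y = - x" by linarith
      then show "x = y" using xy(1,2) assms by (auto simp: antisymmetric_set_def)
    qed
    show "(\<lambda>x. nat \<bar>x\<bar>) ` ?E = {1..n}"
    proof (intro equalityI subsetI)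
      fix k assume "k \<in> (\<lambda>x. nat \<bar>x\<bar>) ` ?E"
      then show "k \<in> {1..n}" using assms
        by (auto simp: antisymmetric_set_def) (metis Suc_leI zero_less_abs_iff zero_less_nat_eq)
    next
      fix k assume k: "k \<in> {1..n}"
      then have "int k \<in> M \<or> - int k \<in> M"
        using assms unfolding antisymmetric_set_def by (metis atLeastAtMost_iff not_one_le_zero of_nat_eq_0_iff)
      then show "k \<in> (\<lambda>x. nat \<bar>x\<bar>) ` ?E"
        using k by (auto intro: rev_image_eqI)
    qed
  qed
  then show ?thesis using bij_betw_same_card by fastforce
qed

text \<open>Let \<open>e\<close> list the \<open>n\<close> elements of \<open>M\<close> in the window in decreasing order. The row lengths
  have to be \<open>e i + i + 1\<close>; they decrease weakly since \<open>e\<close> decreases strictly, and they are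
  nonnegative since \<open>n - 1 - i\<close> elements of the window, all of them at least \<open>-n\<close>, lie below
  \<open>e i\<close>. From index
  \<open>n\<close> on, the rows are empty, which accounts for all integers below the window.\<close>

lemma maya_surj:
  assumes anti: "antisymmetric_set M" and bound: "\<And>x. x \<in> M \<Longrightarrow> x \<le> int n"
  shows "\<exists>\<mu>. is_partition \<mu> \<and> maya \<mu> = M"
proof -
  let ?E = "M \<inter> {- int n..int n}"
  define e where "e i = rev (sorted_list_of_set ?E) ! i" for i
  have len: "length (rev (sorted_list_of_set ?E)) = n"
    using card_window_antisymmetric[OF anti] by simp
  have E: "?E = e ` {..<n}"
  proof -
    have "?E = set (rev (sorted_list_of_set ?E))" by simp
    also have "\<dots> = e ` {..<n}"
      unfolding set_conv_nth len e_def by auto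
    finally show ?thesis .
  qed
  have desc: "e j < e i" if "i < j" "j < n" for i j
  proof -
    have "sorted_wrt (>) (rev (sorted_list_of_set ?E))"
      by (simp add: sorted_wrt_rev)
    then show ?thesis
      using that len unfolding e_def by (auto simp: sorted_wrt_iff_nth_less)
  qed
  have slope: "e j + int j \<le> e i + int i" if "i \<le> j" "j < n" for i j
    using that
  proof (induction j rule: dec_induct)
    case (step m)
    then show ?case using desc[of m "Suc m"] by simp
  qed simp
  have lower: "0 \<le> e i + int i + 1" if "i < n" for i
  proof -
    have "e (n - 1) \<in> ?E" using E that by simp
    moreover have "e (n - 1) + int (n - 1) \<le> e i + int i"
      using slope[of i "n - 1"] that by simp
    ultimately show ?thesis using that by (simp add: of_nat_diff)
  qed
  define p where "p i = (if i < n then nat (e i + int i + 1) else 0)" for i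
  have "\<exists>\<mu>. is_partition \<mu> \<and> row \<mu> = p"
    by (rule partition_with_rows[of p n]) (use slope in \<open>fastforce simp: p_def\<close>)+
  then obtain \<mu> where \<mu>: "is_partition \<mu>" "row \<mu> = p" by blast
  have bead: "bead \<mu> i = (if i < n then e i else - int i - 1)" for i
    using lower by (simp add: bead_def \<mu>(2) p_def)
  have tail: "x \<in> M" if "x < - int n" for x
    using anti bound[of "- x"] that by (auto simp: antisymmetric_set_def)
  have "maya \<mu> = M"
  proof (intro equalityI subsetI)
    fix x assume "x \<in> maya \<mu>"
    then obtain i where x: "x = bead \<mu> i" by (auto simp: maya_def)
    show "x \<in> M"
    proof (cases "i < n")
      case True
      then have "e i \<in> ?E" using E by blast
      then show ?thesis using x True bead by simp
    next
      case False
      then show ?thesis using x bead tail by simp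
    qed
  next
    fix x assume x: "x \<in> M"
    show "x \<in> maya \<mu>"
    proof (cases "x < - int n")
      case True
      then have "n \<le> nat (- x - 1)" and "int (nat (- x - 1)) = - x - 1" by linarith+
      then have "bead \<mu> (nat (- x - 1)) = x" using bead by simp
      then show ?thesis by (metis maya_def rangeI)
    next
      case False
      then have "x \<in> ?E" using x bound[OF x] by simp
      then obtain i where "i < n" "x = e i" using E by auto
      then have "bead \<mu> i = x" using bead by simp
      then show ?thesis by (metis maya_def rangeI)
    qed
  qed
  then show ?thesis using \<mu>(1) by blast
qed

section \<open>Simultaneous cores as sets of lattice points\<close>

definition core_sets :: "nat \<Rightarrow> nat \<Rightarrow> int set set" where
  "core_sets s t = {M. antisymmetric_set M \<and> sub_closed s M \<and> sub_closed t M}"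

text \<open>Placing an integer at each point \<open>(j, i)\<close> of the plane turns closure under subtracting \<open>t\<close>
  into closure under steps to the left, and closure under subtracting \<open>s\<close> into closure under steps
  upwards. The offset in \<open>i + 1\<close> makes \<open>(0, 0)\<close> carry \<open>-s\<close>, the largest multiple of \<open>s\<close> in an
  antisymmetric closed set.\<close>

definition cell :: "nat \<Rightarrow> nat \<Rightarrow> int \<Rightarrow> int \<Rightarrow> int" where
  "cell s t j i = j * int t - (i + 1) * int s"

lemma cell_exists:
  assumes "0 < s" and "coprime s t"
  shows "\<exists>j i. 0 \<le> j \<and> j < int s \<and> x = cell s t j i"
proof -
  obtain u v where uv: "u * int s + v * int t = 1"
    using bezout_int[of "int s" "int t"] assms(2) by auto
  define j where "j = (x * v) mod int s"
  define q where "q = (x * v) div int s"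
  have xv: "x * v = q * int s + j" by (simp add: j_def q_def)
  have "x = x * (u * int s + v * int t)" using uv by simp
  also have "\<dots> = x * u * int s + (x * v) * int t" by (simp add: algebra_simps)
  also have "\<dots> = cell s t j (- (x * u + q * int t) - 1)"
    unfolding xv by (simp add: cell_def algebra_simps)
  finally show ?thesis
    using assms(1) by (intro exI[of _ j] exI conjI) (auto simp: j_def)
qed

lemma cell_mem_mono:
  assumes "sub_closed s M" and "sub_closed t M" and "cell s t j i \<in> M" and "j' \<le> j" and "i \<le> i'"
  shows "cell s t j' i' \<in> M"
proof -
  have "cell s t j i - int (nat (i' - i)) * int s - int (nat (j - j')) * int t \<in> M"
    by (intro sub_closed_mult assms)
  also have "cell s t j i - int (nat (i' - i)) * int s - int (nat (j - j')) * int t = cell s t j' i'"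
    using assms(4,5) by (simp add: cell_def algebra_simps)
  finally show ?thesis .
qed

text \<open>Every integer above \<open>s t\<close> is a nonnegative combination of \<open>s\<close> and \<open>t\<close>, so if it belonged to
  the set then subtracting would reach \<open>0\<close>.\<close>

lemma core_set_bounded:
  assumes "M \<in> core_sets s t" and "0 < s" and "coprime s t" and "x \<in> M"
  shows "x \<le> int (s * t)"
proof (rule ccontr)
  assume big: "\<not> x \<le> int (s * t)"
  obtain j i where ji: "0 \<le> j" "j < int s" "x = cell s t j i"
    using cell_exists[OF assms(2,3)] by blast
  have "j * int t \<le> int s * int t" using ji by (intro mult_right_mono) auto
  then have "(i + 1) * int s < 0" using big ji by (simp add: cell_def)
  then have "i \<le> -1" by (simp add: mult_less_0_iff)
  then have "cell s t 0 (-1) \<in> M"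
    using cell_mem_mono[of s M t j i 0 "-1"] assms(1,4) ji by (simp add: core_sets_def)
  then show False using assms(1) by (simp add: cell_def core_sets_def antisymmetric_set_def)
qed

lemma bij_betw_maya:
  assumes "0 < s" and "0 < t" and "coprime s t"
  shows "bij_betw maya (DD s t) (core_sets s t)"
proof -
  have DD: "\<mu> \<in> DD s t \<longleftrightarrow> is_partition \<mu> \<and> maya \<mu> \<in> core_sets s t" for \<mu>
  proof -
    have "is_partition \<mu>" if "doubled_distinct \<mu>"
      using that by (auto simp: doubled_distinct_def is_doubled_distinct_of_def)
    then show ?thesis
      by (auto simp: DD_def core_sets_def doubled_distinct_iff_antisymmetric
          is_core_iff_sub_closed assms)
  qed
  show ?thesis
    unfolding bij_betw_def
  proof
    show "inj_on maya (DD s t)"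
      by (rule inj_onI) (use DD maya_inject in blast)
    show "maya ` DD s t = core_sets s t"
    proof (intro equalityI subsetI)
      fix M assume M: "M \<in> core_sets s t"
      then have "antisymmetric_set M" by (simp add: core_sets_def)
      then obtain \<mu> where "is_partition \<mu>" "maya \<mu> = M"
        using maya_surj[of M "s * t"] core_set_bounded[OF M assms(1,3)] by blast
      then show "M \<in> maya ` DD s t" using DD M by blast
    qed (use DD in blast)
  qed
qed

section \<open>The heights of a core set\<close>

text \<open>The height at which column \<open>j\<close> enters \<open>M\<close>. Only natural heights need to be searched: for
  \<open>j \<ge> 0\<close> a lower point in \<open>M\<close> would force \<open>0 \<in> M\<close>.\<close>

definition threshold :: "nat \<Rightarrow> nat \<Rightarrow> int set \<Rightarrow> nat \<Rightarrow> nat" where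
  "threshold s t M j = (LEAST k. cell s t (int j) (int k) \<in> M)"

text \<open>The extension of a height function \<open>d\<close> on \<open>{0..s/2}\<close> to all integers: column indices
  between \<open>s/2\<close> and \<open>s\<close> are obtained by the point reflection \<open>j \<mapsto> s - j\<close>, \<open>i \<mapsto> t - 1 - i\<close>, and
  the rest by translation along \<open>(s, t)\<close>.\<close>

definition skyline :: "nat \<Rightarrow> nat \<Rightarrow> (nat \<Rightarrow> nat) \<Rightarrow> int \<Rightarrow> int" where
  "skyline s t d j = j div int s * int t +
     (let r = nat (j mod int s) in if 2 * r \<le> s then int (d r) else int t - 1 - int (d (s - r)))"

definition skyline_set :: "nat \<Rightarrow> nat \<Rightarrow> (nat \<Rightarrow> nat) \<Rightarrow> int set" where
  "skyline_set s t d = {cell s t j i | j i. skyline s t d j \<le> i}"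

locale even_odd_pair =
  fixes h a s t :: nat
  assumes s_eq: "s = 2 * h" and t_eq: "t = 2 * a + 1" and h_pos: "0 < h" and coprime: "coprime s t"
begin

lemma s_pos: "0 < s"
  using s_eq h_pos by simp

lemma cell_uminus: "- cell s t j i = cell s t (- j) (- i - 2)"
  by (simp add: cell_def algebra_simps)

lemma cell_shift: "cell s t (j + k * int s) (i + k * int t) = cell s t j i"
  by (simp add: cell_def algebra_simps)

lemma cell_eq_iff: "cell s t j i = cell s t j' i' \<longleftrightarrow> (\<exists>k. j' = j + k * int s \<and> i' = i + k * int t)"
proof
  assume "cell s t j i = cell s t j' i'"
  then have eq: "(j' - j) * int t = (i' - i) * int s"
    by (simp add: cell_def algebra_simps)
  then have "int s dvd (j' - j) * int t" by simp
  then have "int s dvd j' - j"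
    using coprime by (simp add: coprime_dvd_mult_left_iff)
  then obtain k where k: "j' - j = int s * k" by (auto simp: dvd_def)
  then have "(i' - i) * int s = (k * int t) * int s" using eq by (simp add: algebra_simps)
  then have "i' - i = k * int t" using s_pos by simp
  then show "\<exists>k. j' = j + k * int s \<and> i' = i + k * int t"
    using k by (intro exI[of _ k]) (simp add: algebra_simps)
qed (auto simp: cell_shift)

lemma cell_0: "cell s t 0 (-1) = 0"
  by (simp add: cell_def)

lemma cell_eq_0_iff: "cell s t j i = 0 \<longleftrightarrow> (\<exists>k. j = k * int s \<and> i = k * int t - 1)"
  using cell_eq_iff[of 0 "-1" j i] by (auto simp: cell_0)

lemma cell_mem_imp_nonneg:
  assumes "M \<in> core_sets s t" and "cell s t j i \<in> M" and "0 \<le> j"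
  shows "0 \<le> i"
proof (rule ccontr)
  assume "\<not> 0 \<le> i"
  then have "cell s t 0 (-1) \<in> M"
    using cell_mem_mono[of s M t j i 0 "-1"] assms by (simp add: core_sets_def)
  then show False using assms(1) by (simp add: cell_0 core_sets_def antisymmetric_set_def)
qed

text \<open>Here evenness of \<open>s\<close> enters: the column \<open>h = s/2\<close> contains the integers \<open>\<plusminus>h\<close> at the
  heights \<open>a - 1\<close> and \<open>a\<close>. They differ by \<open>s\<close>, so closure and antisymmetry leave only
  \<open>-h\<close> in the set.\<close>

lemma middle_cells:
  assumes "M \<in> core_sets s t"
  shows "cell s t (int h) (int a) \<in> M" and "cell s t (int h) (int a - 1) \<notin> M"
proof -
  have anti: "antisymmetric_set M" and closed: "sub_closed s M"
    using assms by (simp_all add: core_sets_def)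
  have "int h \<notin> M"
  proof
    assume "int h \<in> M"
    then have "int h - int s \<in> M" using closed by (simp add: sub_closed_def)
    then show False using \<open>int h \<in> M\<close> anti h_pos by (simp add: s_eq antisymmetric_set_def)
  qed
  then show "cell s t (int h) (int a) \<in> M" and "cell s t (int h) (int a - 1) \<notin> M"
    using anti h_pos by (simp_all add: cell_def s_eq t_eq algebra_simps antisymmetric_set_def)
qed

lemma cell_mem_if_ge:
  assumes "M \<in> core_sets s t" and "j \<le> h"
  shows "cell s t (int j) (int a) \<in> M"
  using cell_mem_mono[of s M t "int h" "int a" "int j" "int a"] middle_cells(1)[OF assms(1)] assms
  by (simp add: core_sets_def)

lemma cell_mem_iff_threshold_le:
  assumes "M \<in> core_sets s t" and "j \<le> h"
  shows "cell s t (int j) i \<in> M \<longleftrightarrow> int (threshold s t M j) \<le> i"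
proof
  assume mem: "cell s t (int j) i \<in> M"
  then have "0 \<le> i" using cell_mem_imp_nonneg[OF assms(1)] by simp
  then have "threshold s t M j \<le> nat i"
    unfolding threshold_def using mem by (intro Least_le) simp
  then show "int (threshold s t M j) \<le> i" using \<open>0 \<le> i\<close> by simp
next
  assume "int (threshold s t M j) \<le> i"
  moreover have "cell s t (int j) (int (threshold s t M j)) \<in> M"
    unfolding threshold_def by (rule LeastI) (rule cell_mem_if_ge[OF assms])
  ultimately show "cell s t (int j) i \<in> M"
    using cell_mem_mono[of s M t "int j" _ "int j" i] assms(1) by (simp add: core_sets_def)
qed

lemma threshold_le:
  assumes "M \<in> core_sets s t" and "j \<le> h"
  shows "threshold s t M j \<le> a"
  using cell_mem_iff_threshold_le[OF assms, of "int a"] cell_mem_if_ge[OF assms] by simp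

lemma threshold_mono:
  assumes "M \<in> core_sets s t" and "j \<le> j'" and "j' \<le> h"
  shows "threshold s t M j \<le> threshold s t M j'"
proof -
  have "cell s t (int j') (int (threshold s t M j')) \<in> M"
    using cell_mem_iff_threshold_le[OF assms(1,3)] by simp
  then have "cell s t (int j) (int (threshold s t M j')) \<in> M"
    using cell_mem_mono[of s M t "int j'" _ "int j"] assms by (simp add: core_sets_def)
  then show ?thesis
    using cell_mem_iff_threshold_le[OF assms(1), of j] assms by simp
qed

lemma threshold_0:
  assumes "M \<in> core_sets s t"
  shows "threshold s t M 0 = 0"
proof -
  have anti: "antisymmetric_set M" and closed: "sub_closed s M"
    using assms by (simp_all add: core_sets_def)
  have "int s \<notin> M"
    using anti closed by (auto simp: antisymmetric_set_def sub_closed_def)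
  then have "cell s t (int 0) 0 \<in> M"
    using anti s_pos by (simp add: cell_def antisymmetric_set_def)
  then show ?thesis using cell_mem_iff_threshold_le[OF assms, of 0 0] by simp
qed

lemma threshold_h:
  assumes "M \<in> core_sets s t"
  shows "threshold s t M h = a"
  using middle_cells[OF assms] cell_mem_iff_threshold_le[OF assms, of h] by fastforce

text \<open>Columns \<open>0, \<dots>, h\<close> contain every residue class modulo \<open>s\<close> up to sign. An integer in a
  column between \<open>h\<close> and \<open>s\<close> is nonzero and its negative lies in one of these columns, so antisymmetry
  settles its membership.\<close>

lemma core_set_eqI:
  assumes M: "M \<in> core_sets s t" and N: "N \<in> core_sets s t"
    and eq: "\<And>j. j \<le> h \<Longrightarrow> threshold s t M j = threshold s t N j"
  shows "M = N"
proof -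
  have left: "cell s t j i \<in> M \<longleftrightarrow> cell s t j i \<in> N" if "0 \<le> j" "j \<le> int h" for j i
    using cell_mem_iff_threshold_le[OF M, of "nat j" i] cell_mem_iff_threshold_le[OF N, of "nat j" i]
      eq[of "nat j"] that by (simp add: nat_le_iff)
  have "x \<in> M \<longleftrightarrow> x \<in> N" for x
  proof -
    obtain j i where ji: "0 \<le> j" "j < int s" "x = cell s t j i"
      using cell_exists[OF s_pos coprime] by blast
    show ?thesis
    proof (cases "j \<le> int h")
      case True
      then show ?thesis using left ji by simp
    next
      case False
      have "- x = cell s t (int s - j) (int t - i - 2)"
        using cell_shift[of "- j" 1 "- i - 2"] ji by (simp add: cell_uminus algebra_simps)
      then have "- x \<in> M \<longleftrightarrow> - x \<in> N"
        using left[of "int s - j"] False ji(2) by (simp add: s_eq)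
      moreover have "x \<noteq> 0"
      proof
        assume "x = 0"
        then have "cell s t j i = 0" using ji(3) by simp
        then obtain k where k: "j = k * int s" unfolding cell_eq_0_iff by blast
        have "0 < j" using False by simp
        then have "1 \<le> k" using k s_pos by (simp add: zero_less_mult_iff)
        then have "int s \<le> j" using k s_pos by simp
        then show False using ji(2) by simp
      qed
      ultimately show ?thesis using M N by (simp add: core_sets_def antisymmetric_set_def)
    qed
  qed
  then show ?thesis by blast
qed

end

section \<open>Every height function occurs\<close>

text \<open>The height functions that can occur on columns \<open>0, \<dots>, h\<close>. The two boundary values are
  the ones that antisymmetry forces.\<close>

locale half_profile = even_odd_pair +
  fixes d :: "nat \<Rightarrow> nat"
  assumes d_mono: "\<And>j j'. j \<le> j' \<Longrightarrow> j' \<le> h \<Longrightarrow> d j \<le> d j'"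
    and d_0: "d 0 = 0" and d_h: "d h = a"
begin

lemma skyline_shift: "skyline s t d (j + k * int s) = skyline s t d j + k * int t"
proof -
  have "(j + k * int s) div int s = k + j div int s" and "(j + k * int s) mod int s = j mod int s"
    using s_pos by simp_all
  then show ?thesis unfolding skyline_def by (simp add: distrib_right)
qed

lemma skyline_left:
  assumes "0 \<le> j" and "j \<le> int h"
  shows "skyline s t d j = int (d (nat j))"
proof -
  have "j < int s" and "2 * nat j \<le> s" using assms h_pos s_eq by linarith+
  then show ?thesis using assms(1) by (simp add: skyline_def)
qed

text \<open>At \<open>j = h\<close> both branches of the definition give the same value, because
  \<open>d h = a = t - 1 - a\<close>. So the reflected branch is valid on the closed half period.\<close>

lemma skyline_right:
  assumes "int h \<le> j" and "j < int s"
  shows "skyline s t d j = int t - 1 - int (d (nat (int s - j)))"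
proof (cases "j = int h")
  case True
  then show ?thesis using skyline_left[of j] d_h by (simp add: s_eq t_eq)
next
  case False
  have "nat (int s - j) = s - nat j" and "\<not> 2 * nat j \<le> s" and "0 \<le> j"
    using False assms s_eq by linarith+
  then show ?thesis using assms(2) by (simp add: skyline_def)
qed

lemma skyline_reflect:
  assumes "0 < j" and "j < int s"
  shows "skyline s t d (int s - j) = int t - 1 - skyline s t d j"
proof (cases "j \<le> int h")
  case True
  then show ?thesis using skyline_left[of j] skyline_right[of "int s - j"] assms by (simp add: s_eq)
next
  case False
  then show ?thesis using skyline_right[of j] skyline_left[of "int s - j"] assms by (simp add: s_eq)
qed

lemma skyline_uminus:
  assumes "\<not> int s dvd j"
  shows "skyline s t d (- j) = - 1 - skyline s t d j"
proof -
  define r q where "r = j mod int s" and "q = j div int s"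
  have j: "j = r + q * int s" by (simp add: r_def q_def)
  have "r \<noteq> 0" using assms by (simp add: r_def dvd_eq_mod_eq_0)
  moreover have "0 \<le> r" "r < int s" using s_pos by (simp_all add: r_def)
  ultimately have r: "0 < r" "r < int s" by simp_all
  have "skyline s t d (- j) = skyline s t d ((int s - r) + (- q - 1) * int s)"
    by (simp add: j algebra_simps)
  also have "\<dots> = skyline s t d (int s - r) + (- q - 1) * int t"
    by (rule skyline_shift)
  also have "\<dots> = - 1 - skyline s t d j"
    unfolding skyline_reflect[OF r] j skyline_shift by (simp add: algebra_simps)
  finally show ?thesis .
qed

lemma skyline_mult: "skyline s t d (k * int s) = k * int t"
  using skyline_shift[of 0 k] skyline_left[of 0] d_0 by simp

text \<open>Within either half period this is monotonicity of \<open>d\<close>. At the end of a period the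
  step goes from \<open>t - 1 - d 1\<close> to \<open>t\<close>.\<close>

lemma skyline_step: "skyline s t d j \<le> skyline s t d (j + 1)"
proof -
  define r q where "r = j mod int s" and "q = j div int s"
  have j: "j = r + q * int s" by (simp add: r_def q_def)
  have r: "0 \<le> r" "r < int s"
    using s_pos by (auto simp: r_def)
  have "skyline s t d r \<le> skyline s t d (r + 1)"
  proof -
    consider "r < int h" | "int h \<le> r" "r + 1 < int s" | "r + 1 = int s" "int h \<le> r"
      using r h_pos s_eq by linarith
    then show ?thesis
    proof cases
      case 1
      then show ?thesis
        using skyline_left[of r] skyline_left[of "r + 1"] d_mono[of "nat r" "nat (r + 1)"] r
        by (simp add: nat_le_iff)
    next
      case 2
      then have "d (nat (int s - (r + 1))) \<le> d (nat (int s - r))"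
        by (intro d_mono) (auto simp: s_eq)
      then show ?thesis
        using skyline_right[of r] skyline_right[of "r + 1"] 2 by simp
    next
      case 3
      then show ?thesis
        using skyline_right[of r] skyline_mult[of 1] by simp
    qed
  qed
  then show ?thesis
    using skyline_shift[of r q] skyline_shift[of "r + 1" q] by (simp add: j algebra_simps)
qed

lemma skyline_mono:
  assumes "j \<le> j'"
  shows "skyline s t d j \<le> skyline s t d j'"
  using assms
proof (induction j' rule: int_ge_induct)
  case (step i)
  then show ?case using skyline_step[of i] by simp
qed simp

lemma cell_mem_skyline_set_iff:
  "cell s t j i \<in> skyline_set s t d \<longleftrightarrow> skyline s t d j \<le> i"
proof
  assume "cell s t j i \<in> skyline_set s t d"
  then obtain j' i' where "cell s t j i = cell s t j' i'" and le: "skyline s t d j' \<le> i'"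
    by (auto simp: skyline_set_def)
  then obtain k where "j' = j + k * int s" "i' = i + k * int t"
    by (auto simp: cell_eq_iff)
  then show "skyline s t d j \<le> i" using le by (simp add: skyline_shift)
qed (auto simp: skyline_set_def)

text \<open>Upward and leftward closure are clear from the shape of the region and from monotonicity.
  Negation sends the point \<open>(j, i)\<close> to \<open>(-j, -i - 2)\<close>, and \<open>D (-j) \<le> -i - 2\<close> with \<open>D (-j) = -1 - D j\<close>
  means \<open>i < D j\<close>. In the columns \<open>j = k s\<close> one has \<open>D (-j) = -D j\<close> instead; the two conditions then
  differ only at the height \<open>k t - 1\<close>, where the integer is \<open>0\<close>.\<close>

lemma skyline_set_mem_core_sets: "skyline_set s t d \<in> core_sets s t"
proof -
  let ?M = "skyline_set s t d"
  have "sub_closed s ?M"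
    unfolding sub_closed_def
  proof
    fix x assume "x \<in> ?M"
    then obtain j i where "x = cell s t j i" "skyline s t d j \<le> i"
      by (auto simp: skyline_set_def)
    moreover from this have "x - int s = cell s t j (i + 1)" by (simp add: cell_def algebra_simps)
    ultimately show "x - int s \<in> ?M" by (simp add: cell_mem_skyline_set_iff)
  qed
  moreover have "sub_closed t ?M"
    unfolding sub_closed_def
  proof
    fix x assume "x \<in> ?M"
    then obtain j i where "x = cell s t j i" "skyline s t d j \<le> i"
      by (auto simp: skyline_set_def)
    moreover from this have "x - int t = cell s t (j - 1) i" by (simp add: cell_def algebra_simps)
    ultimately show "x - int t \<in> ?M"
      using skyline_mono[of "j - 1" j] by (simp add: cell_mem_skyline_set_iff)
  qed
  moreover have "antisymmetric_set ?M"
    unfolding antisymmetric_set_def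
  proof (intro conjI allI impI)
    show "0 \<notin> ?M"
      using cell_mem_skyline_set_iff[of 0 "-1"] skyline_mult[of 0] by (simp add: cell_0)
  next
    fix x :: int assume "x \<noteq> 0"
    obtain j i where x: "x = cell s t j i"
      using cell_exists[OF s_pos coprime] by blast
    have iff: "- x \<in> ?M \<longleftrightarrow> skyline s t d (- j) \<le> - i - 2" "x \<in> ?M \<longleftrightarrow> skyline s t d j \<le> i"
      unfolding x cell_uminus cell_mem_skyline_set_iff by simp_all
    show "- x \<in> ?M \<longleftrightarrow> x \<notin> ?M"
    proof (cases "int s dvd j")
      case True
      then obtain k where k: "j = k * int s" by (auto simp: dvd_def mult.commute)
      then have "i \<noteq> k * int t - 1"
        using \<open>x \<noteq> 0\<close> cell_eq_0_iff[of j i] unfolding x by blast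
      then show ?thesis
        unfolding iff using skyline_mult[of k] skyline_mult[of "- k"] k by auto
    next
      case False
      then show ?thesis unfolding iff using skyline_uminus[of j] by auto
    qed
  qed
  ultimately show ?thesis by (simp add: core_sets_def)
qed

lemma threshold_skyline_set:
  assumes "j \<le> h"
  shows "threshold s t (skyline_set s t d) j = d j"
proof -
  have "cell s t (int j) i \<in> skyline_set s t d \<longleftrightarrow> int (d j) \<le> i" for i
    using skyline_left[of "int j"] assms by (simp add: cell_mem_skyline_set_iff)
  then show ?thesis
    using cell_mem_iff_threshold_le[OF skyline_set_mem_core_sets assms] by (metis dual_order.eq_iff of_nat_le_iff)
qed

end

section \<open>North-east paths as weakly increasing lists\<close>

lemma walk_shift: "walk p w = p + walk (0, 0) w"
proof (induction w arbitrary: p)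
  case (Cons x w)
  have "walk p (x # w) = p + (step_vec x + walk (0, 0) w)"
    using Cons[of "p + step_vec x"] by (simp add: add.assoc)
  also have "step_vec x + walk (0, 0) w = walk (0, 0) (x # w)"
    using Cons[of "(0, 0) + step_vec x"] by (simp add: prod_eq_iff)
  finally show ?case .
qed (simp add: prod_eq_iff)

lemma walk_North: "walk (0, 0) (North # w) = (0, 1) + walk (0, 0) w"
  using walk_shift[of "(0, 1)" w] by simp

lemma walk_East: "walk (0, 0) (East # w) = (1, 0) + walk (0, 0) w"
  using walk_shift[of "(1, 0)" w] by simp

lemma Nil_mem_NE_iff: "[] \<in> NE a b \<longleftrightarrow> a = 0 \<and> b = 0"
  by (auto simp: NE_def)

lemma North_mem_NE_iff: "North # w \<in> NE a b \<longleftrightarrow> 0 < b \<and> w \<in> NE a (b - 1)"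
proof -
  obtain x y where "walk (0, 0) w = (x, y)" by fastforce
  then show ?thesis unfolding NE_def mem_Collect_eq walk_North by auto
qed

lemma East_mem_NE_iff: "East # w \<in> NE a b \<longleftrightarrow> 0 < a \<and> w \<in> NE (a - 1) b"
proof -
  obtain x y where "walk (0, 0) w = (x, y)" by fastforce
  then show ?thesis unfolding NE_def mem_Collect_eq walk_East by auto
qed

lemmas mem_NE_simps = Nil_mem_NE_iff North_mem_NE_iff East_mem_NE_iff

lemma NE_decompose:
  "NE a b = (if a = 0 \<and> b = 0 then {[]} else {}) \<union>
     (if 0 < b then (#) North ` NE a (b - 1) else {}) \<union>
     (if 0 < a then (#) East ` NE (a - 1) b else {})"  (is "_ = ?R")
proof (rule set_eqI)
  fix w
  have Cons_mem_image: "x # v \<in> (#) y ` A \<longleftrightarrow> x = y \<and> v \<in> A" for x y :: step and v A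
    by blast
  show "w \<in> NE a b \<longleftrightarrow> w \<in> ?R"
  proof (cases w)
    case Nil
    have "[] \<notin> (#) y ` A" for y :: step and A by blast
    then show ?thesis unfolding Nil by (simp add: Nil_mem_NE_iff)
  next
    case (Cons x v)
    show ?thesis
      unfolding Cons
      by (cases x) (simp_all add: North_mem_NE_iff East_mem_NE_iff Cons_mem_image del: image_iff)
  qed
qed

lemma finite_card_NE: "finite (NE a b) \<and> card (NE a b) = (a + b) choose b"
proof (induction "a + b" arbitrary: a b rule: less_induct)
  case less
  have N: "finite (NE a (b - 1))" "card (NE a (b - 1)) = (a + b - 1) choose (b - 1)" if "0 < b"
    using less[of a "b - 1"] that by auto
  have E: "finite (NE (a - 1) b)" "card (NE (a - 1) b) = (a + b - 1) choose b" if "0 < a"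
    using less[of "a - 1" b] that by auto
  consider "a = 0" "b = 0" | "a = 0" "0 < b" | "0 < a" "b = 0" | "0 < a" "0 < b" by blast
  then show ?case
  proof cases
    case 1
    then show ?thesis using NE_decompose[of a b] by simp
  next
    case 2
    then show ?thesis using NE_decompose[of a b] N by (simp add: card_image)
  next
    case 3
    then show ?thesis using NE_decompose[of a b] E by (simp add: card_image)
  next
    case 4
    have NE: "NE a b = (#) North ` NE a (b - 1) \<union> (#) East ` NE (a - 1) b"
      using NE_decompose[of a b] 4 by simp
    have "card (NE a b) = card (NE a (b - 1)) + card (NE (a - 1) b)"
      unfolding NE using N(1)[OF 4(2)] E(1)[OF 4(1)]
      by (subst card_Un_disjoint) (auto simp: card_image)
    also have "\<dots> = ((a + b - 1) choose (b - 1)) + ((a + b - 1) choose b)"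
      unfolding N(2)[OF 4(2)] E(2)[OF 4(1)] ..
    also have "\<dots> = (a + b) choose b"
      using 4 choose_reduce_nat[of "a + b" b] by simp
    finally show ?thesis
      using N(1)[OF 4(2)] E(1)[OF 4(1)] by (simp add: NE)
  qed
qed

text \<open>The lower bound \<open>k\<close> is variable so that inductions can start in the middle of a path.\<close>

definition height_lists :: "nat \<Rightarrow> nat \<Rightarrow> nat \<Rightarrow> nat list set" where
  "height_lists k a b = {xs. length xs = b \<and> sorted xs \<and> set xs \<subseteq> {k..k + a}}"

text \<open>The argument \<open>k\<close> accumulates the east steps already taken.\<close>

fun easts_before_norths :: "nat \<Rightarrow> step list \<Rightarrow> nat list" where
  "easts_before_norths k [] = []"
| "easts_before_norths k (North # w) = k # easts_before_norths k w"
| "easts_before_norths k (East # w) = easts_before_norths (Suc k) w"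

lemma easts_before_norths_mem:
  "w \<in> NE a b \<Longrightarrow> easts_before_norths k w \<in> height_lists k a b"
proof (induction k w arbitrary: a b rule: easts_before_norths.induct)
  case (2 k w)
  then have "easts_before_norths k w \<in> height_lists k a (b - 1)" and "0 < b"
    by (auto simp: mem_NE_simps)
  then show ?case by (auto simp: height_lists_def)
next
  case (3 k w)
  then have "easts_before_norths (Suc k) w \<in> height_lists (Suc k) (a - 1) b" and "0 < a"
    by (auto simp: mem_NE_simps)
  then show ?case by (fastforce simp: height_lists_def)
qed (auto simp: height_lists_def mem_NE_simps)

text \<open>The first steps agree, because a path starting with a north step begins its list with
  \<open>k\<close> whereas all entries exceed \<open>k\<close> after an east step. The common end point takes care of the trailing
  east steps, which leave no trace in the list.\<close>

lemma easts_before_norths_inject: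
  assumes "w \<in> NE a b" and "w' \<in> NE a b" and "easts_before_norths k w = easts_before_norths k w'"
  shows "w = w'"
  using assms
proof (induction w arbitrary: w' k a b)
  case Nil
  then have "a = 0" "b = 0" by (simp_all add: mem_NE_simps)
  then have "NE a b = {[]}" using NE_decompose[of 0 0] by simp
  then show ?case using Nil by simp
next
  case (Cons x w)
  have clash: "easts_before_norths (Suc k) v \<noteq> k # ys" if "v \<in> NE a' b'" for v ys a' b'
    using easts_before_norths_mem[OF that, of "Suc k"] by (auto simp: height_lists_def)
  have "w' \<noteq> []"
    using Cons.prems(1,2) by (cases x) (auto simp: mem_NE_simps)
  then obtain y v where w': "w' = y # v" by (cases w') auto
  show ?case
  proof (cases x)
    case North
    then have "w \<in> NE a (b - 1)" using Cons.prems(1) by (simp add: mem_NE_simps)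
    moreover have "y = North"
      using Cons.prems clash[of v "a - 1" b "easts_before_norths k w"]
      by (cases y) (auto simp: w' North mem_NE_simps)
    ultimately show ?thesis
      using Cons.IH[of a "b - 1" v k] Cons.prems by (simp add: w' North mem_NE_simps)
  next
    case East
    then have "w \<in> NE (a - 1) b" using Cons.prems(1) by (simp add: mem_NE_simps)
    moreover have "y = East"
      using Cons.prems clash[of w "a - 1" b] by (cases y) (auto simp: w' East mem_NE_simps)
    ultimately show ?thesis
      using Cons.IH[of "a - 1" b v "Suc k"] Cons.prems by (simp add: w' East mem_NE_simps)
  qed
qed

lemma easts_before_norths_replicate:
  "easts_before_norths k (replicate n East @ w) = easts_before_norths (k + n) w"
  by (induction n arbitrary: k) auto

lemma replicate_East_mem_NE_iff:
  "replicate n East @ w \<in> NE a b \<longleftrightarrow> n \<le> a \<and> w \<in> NE (a - n) b"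
proof (induction n arbitrary: a)
  case (Suc n)
  show ?case by (cases a) (simp_all add: East_mem_NE_iff Suc)
qed simp

lemma easts_before_norths_surj:
  assumes "xs \<in> height_lists k a b"
  shows "\<exists>w\<in>NE a b. easts_before_norths k w = xs"
  using assms
proof (induction xs arbitrary: k a b)
  case Nil
  then have "replicate a East @ [] \<in> NE a b"
    unfolding replicate_East_mem_NE_iff by (simp add: height_lists_def mem_NE_simps)
  moreover have "easts_before_norths k (replicate a East @ []) = []"
    unfolding easts_before_norths_replicate by simp
  ultimately show ?case by blast
next
  case (Cons x xs)
  then have "xs \<in> height_lists x (a - (x - k)) (b - 1)" and x: "k \<le> x" "x \<le> k + a" and b: "0 < b"
    by (auto simp: height_lists_def)
  then obtain w where w: "w \<in> NE (a - (x - k)) (b - 1)" "easts_before_norths x w = xs"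
    using Cons.IH by blast
  have "replicate (x - k) East @ North # w \<in> NE a b"
    unfolding replicate_East_mem_NE_iff using w x b by (simp add: mem_NE_simps)
  moreover have "easts_before_norths k (replicate (x - k) East @ North # w) = x # xs"
    unfolding easts_before_norths_replicate using w x by simp
  ultimately show ?case by blast
qed

lemma bij_betw_easts_before_norths:
  "bij_betw (easts_before_norths 0) (NE a b) (height_lists 0 a b)"
  unfolding bij_betw_def
proof
  show "inj_on (easts_before_norths 0) (NE a b)"
    by (rule inj_onI) (rule easts_before_norths_inject)
  show "easts_before_norths 0 ` NE a b = height_lists 0 a b"
  proof (intro equalityI subsetI)
    fix xs assume "xs \<in> height_lists 0 a b"
    then show "xs \<in> easts_before_norths 0 ` NE a b"
      using easts_before_norths_surj by blast
  qed (use easts_before_norths_mem in blast)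
qed

section \<open>The bijection\<close>

context even_odd_pair
begin

text \<open>The columns \<open>0\<close> and \<open>h\<close> are left out, since their thresholds are \<open>0\<close> and \<open>a\<close> for every
  core set.\<close>

definition heights :: "int set \<Rightarrow> nat list" where
  "heights M = map (threshold s t M) [1..<h]"

lemma heights_mem:
  assumes "M \<in> core_sets s t"
  shows "heights M \<in> height_lists 0 a (h - 1)"
proof -
  have "sorted (heights M)"
    using threshold_mono[OF assms] by (auto simp: heights_def sorted_iff_nth_mono)
  then show ?thesis
    using threshold_le[OF assms] by (auto simp: heights_def height_lists_def)
qed

lemma heights_inject:
  assumes "M \<in> core_sets s t" and "N \<in> core_sets s t" and "heights M = heights N"
  shows "M = N"
proof (rule core_set_eqI[OF assms(1,2)])
  fix j assume "j \<le> h"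
  then consider "j = 0" | "j = h" | "j \<in> set [1..<h]" by fastforce
  then show "threshold s t M j = threshold s t N j"
  proof cases
    case 3
    then show ?thesis using assms(3) unfolding heights_def map_eq_conv by blast
  qed (use threshold_0 threshold_h assms in simp_all)
qed

lemma heights_surj:
  assumes "xs \<in> height_lists 0 a (h - 1)"
  shows "\<exists>M\<in>core_sets s t. heights M = xs"
proof -
  define ys where "ys = 0 # xs @ [a]"
  define d where "d j = ys ! j" for j
  have len: "length xs = h - 1" and xs: "sorted xs" "\<And>x. x \<in> set xs \<Longrightarrow> x \<le> a"
    using assms by (auto simp: height_lists_def)
  have ys: "sorted ys" "length ys = h + 1"
    using xs len h_pos by (auto simp: ys_def sorted_append)
  interpret half_profile h a s t d
  proof
    show "d j \<le> d j'" if "j \<le> j'" "j' \<le> h" for j j'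
      using sorted_nth_mono[OF ys(1), of j j'] that ys(2) by (simp add: d_def)
    show "d 0 = 0" by (simp add: d_def ys_def)
    show "d h = a" using len h_pos by (cases h) (auto simp: d_def ys_def nth_append)
  qed
  have "heights (skyline_set s t d) = xs"
    unfolding heights_def
    by (rule nth_equalityI)
       (auto simp: len threshold_skyline_set d_def ys_def nth_append)
  then show ?thesis using skyline_set_mem_core_sets by blast
qed

lemma bij_betw_heights: "bij_betw heights (core_sets s t) (height_lists 0 a (h - 1))"
  unfolding bij_betw_def
proof
  show "inj_on heights (core_sets s t)"
    by (rule inj_onI) (rule heights_inject)
  show "heights ` core_sets s t = height_lists 0 a (h - 1)"
    using heights_mem heights_surj by blast
qed

end

theorem theorem3p3:
  fixes s t :: nat
  assumes "0 < s" and "even s" and "0 < t" and "odd t" and "coprime s t"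
  shows "(\<exists>f. bij_betw f (DD s t) (NE ((t - 1) div 2) ((s - 2) div 2))) \<and>
         card (DD s t) = ((s - 2) div 2 + (t - 1) div 2) choose ((s - 2) div 2)"
proof -
  define h a where "h = s div 2" and "a = (t - 1) div 2"
  interpret even_odd_pair h a s t
    using assms by unfold_locales (auto simp: h_def a_def elim!: evenE oddE)
  have b: "(s - 2) div 2 = h - 1" by (simp add: h_def)
  have "bij_betw (heights \<circ> maya) (DD s t) (height_lists 0 a (h - 1))"
    using bij_betw_maya[OF assms(1,3,5)] bij_betw_heights by (rule bij_betw_trans)
  then have "bij_betw (the_inv_into (NE a (h - 1)) (easts_before_norths 0) \<circ> (heights \<circ> maya))
      (DD s t) (NE a (h - 1))"
    using bij_betw_the_inv_into[OF bij_betw_easts_before_norths] by (rule bij_betw_trans)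
  moreover from this have "card (DD s t) = (h - 1 + a) choose (h - 1)"
    using bij_betw_same_card finite_card_NE[of a "h - 1"] by (fastforce simp: add.commute)
  ultimately show ?thesis unfolding b a_def[symmetric] by blast
qed

end
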